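(* Let $(E,d)$ be a locally and boundedly compact metric space with an origin $\mathbf o\in E$. Suppose that for each $k\ge1$ we have a sequence of distinct points $(x_i^{(k)})_{i\ge1}$ of $E$, ranked by increasing distances to $\mathbf o$, with $d(\mathbf o,x_i^{(k)})\to\infty$ as $i\to\infty$, which together satisfy: (i) (Convergence to the boundary) for all $i\ge1$, $x_i^{(k)}\to\theta_i\in\partial E$ in the Gromov sense as $k\to\infty$; (ii) (Convergence of proto-delays) for all $i\ge1$, $d(x_i^{(k)},\mathbf o)-d(x_1^{(k)},\mathbf o)\to\delta_i\in\mathbb R$ as $k\to\infty$; furthermore $\delta_i\to\infty$ as $i\to\infty$; (iii) (Nondegeneracy) the ideal Voronoi diagram $\mathrm{Vor}\big((\theta_i,\delta_i); i\ge1\big)$ is nondegenerate. Then the Voronoi diagrams $\mathrm{Vor}(x_i^{(k)}; i\ge1)$ converge as $k\to\infty$ to the ideal Voronoi diagram $\mathrm{Vor}\big((\theta_i,\delta_i); i\ge1\big)$.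
   Context: Gromov boundary: let $C(E)$ be the space of real continuous functions on $E$ with uniform convergence on compact sets and $C(E)/\mathbb R$ its quotient by additive constants, with quotient topology. $E$ embeds via $x\mapsto$ class of $d(x,\cdot)$. The Gromov boundary $\partial E$ is the set of points of the closure of the image of $E$ in $C(E)/\mathbb R$ that are not in the image. For $\theta\in\partial E$, $\mathrm d_\theta$ denotes the representative function with $\mathrm d_\theta(\mathbf o)=0$. Gromov convergence $x^{(k)}\to\theta$ means $d(x^{(k)},\cdot)-d(x^{(k)},\mathbf o)\to \mathrm d_\theta$ uniformly on compact sets. Voronoi diagram: $\mathrm{Vor}(x_i; i\ge1)=(C_i)_{i\ge1}$ with $C_i=\{w\in E: d(w,x_i)\le d(w,x_j)\ \forall j\}$. Ideal Voronoi diagram: for $(\theta_i,\delta_i)\in\partial E\times\mathbb R$ with $(\delta_i)$ increasing (in the weak sense) and tending to $\infty$, $\mathrm{Vor}((\theta_i,\delta_i); i\ge1)=(C_i)_{i\ge1}$ with $C_i=\{x\in E: \mathrm d_{\theta_i}(x)+\delta_i\le \mathrm d_{\theta_j}(x)+\delta_j\ \forall j\ne i\}$; $C_i^\circ$ is defined with strict inequalities. The diagram is nondegenerate if $\overline{C_i^\circ}=C_i$ for every $i\ge1$. Convergence of diagrams: $(C_i^{(k)})_{i\ge1}\to(C_i)_{i\ge1}$ means that for each $i$, $C_i^{(k)}\to C_i$ in the Fell topology on closed subsets of $E$, generated by the sets $\{F: F\cap K=\varnothing\}$, $K$ compact, and $\{F: F\cap G\ne\varnothing\}$, $G$ open. 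*)

theory Defs
  imports "HOL-Analysis.Analysis"
begin

section \<open>The space of continuous functions modulo constants\<close>

definition continuous_functions :: "('a::metric_space \<Rightarrow> real) set" where
  "continuous_functions = {f. continuous_on UNIV f}"

text \<open>The topology of uniform convergence on compact sets, given by the basic neighbourhoods
  \<open>{g. \<forall>y\<in>K. \<bar>g y - f y\<bar> < e}\<close> of \<open>f\<close>. The lemma \<open>limitin_cc_topology\<close> identifies its limits.\<close>

definition cc_topology :: "('a::metric_space \<Rightarrow> real) topology" where
  "cc_topology = topology (\<lambda>U. U \<subseteq> continuous_functions \<and>
     (\<forall>f\<in>U. \<exists>K e. compact K \<and> e > 0 \<and>
        {g \<in> continuous_functions. \<forall>y\<in>K. dist (g y) (f y) < e} \<subseteq> U))"

lemma openin_cc_topology: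
  "openin cc_topology U \<longleftrightarrow> U \<subseteq> continuous_functions \<and>
     (\<forall>f\<in>U. \<exists>K e. compact K \<and> e > 0 \<and>
        {g \<in> continuous_functions. \<forall>y\<in>K. dist (g y) (f y) < e} \<subseteq> U)"
proof -
  let ?P = "\<lambda>U :: ('a \<Rightarrow> real) set. U \<subseteq> continuous_functions \<and>
     (\<forall>f\<in>U. \<exists>K e. compact K \<and> e > 0 \<and>
        {g \<in> continuous_functions. \<forall>y\<in>K. dist (g y) (f y) < e} \<subseteq> U)"
  have "istopology ?P"
    unfolding istopology_def
  proof (intro conjI allI impI)
    fix S T assume S: "?P S" and T: "?P T"
    show "S \<inter> T \<subseteq> continuous_functions" using S by blast
    show "\<forall>f\<in>S \<inter> T. \<exists>K e. compact K \<and> e > 0 \<and>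
        {g \<in> continuous_functions. \<forall>y\<in>K. dist (g y) (f y) < e} \<subseteq> S \<inter> T"
    proof
      fix f assume f: "f \<in> S \<inter> T"
      obtain K d where 1: "compact K" "d > 0"
        "{g \<in> continuous_functions. \<forall>y\<in>K. dist (g y) (f y) < d} \<subseteq> S" using S f by blast
      obtain L e where 2: "compact L" "e > 0"
        "{g \<in> continuous_functions. \<forall>y\<in>L. dist (g y) (f y) < e} \<subseteq> T" using T f by blast
      show "\<exists>K e. compact K \<and> e > 0 \<and>
        {g \<in> continuous_functions. \<forall>y\<in>K. dist (g y) (f y) < e} \<subseteq> S \<inter> T"
      proof (intro exI conjI)
        show "compact (K \<union> L)" using 1(1) 2(1) by (rule compact_Un)
        show "min d e > 0" using 1 2 by simp
        show "{g \<in> continuous_functions. \<forall>y\<in>K \<union> L. dist (g y) (f y) < min d e} \<subseteq> S \<inter> T"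
          using 1(3) 2(3) by auto
      qed
    qed
  next
    fix \<K> assume *: "\<forall>S\<in>\<K>. ?P S"
    show "\<Union>\<K> \<subseteq> continuous_functions" using * by blast
    show "\<forall>f\<in>\<Union>\<K>. \<exists>K e. compact K \<and> e > 0 \<and>
        {g \<in> continuous_functions. \<forall>y\<in>K. dist (g y) (f y) < e} \<subseteq> \<Union>\<K>"
    proof
      fix f assume "f \<in> \<Union>\<K>"
      then obtain S where S: "S \<in> \<K>" "f \<in> S" by blast
      have "?P S" using * S(1) by (rule bspec)
      then obtain K e where "compact K" "e > 0"
        "{g \<in> continuous_functions. \<forall>y\<in>K. dist (g y) (f y) < e} \<subseteq> S"
        using S(2) by (elim conjE bspec[elim_format]) auto
      then show "\<exists>K e. compact K \<and> e > 0 \<and>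
        {g \<in> continuous_functions. \<forall>y\<in>K. dist (g y) (f y) < e} \<subseteq> \<Union>\<K>"
        using S(1) by (intro exI[of _ K] exI[of _ e]) auto
    qed
  qed
  then show ?thesis by (simp add: cc_topology_def)
qed

lemma topspace_cc_topology [simp]: "topspace cc_topology = continuous_functions"
proof -
  have "openin cc_topology (continuous_functions :: ('a \<Rightarrow> real) set)"
    unfolding openin_cc_topology by (auto intro!: exI[of _ "{}"] exI[of _ "1::real"])
  moreover have "topspace cc_topology \<subseteq> (continuous_functions :: ('a \<Rightarrow> real) set)"
    using openin_topspace openin_cc_topology by (rule iffD1[THEN conjunct1, rotated])
  ultimately show ?thesis by (meson openin_subset subset_antisym)
qed

lemma limitin_cc_topology:
  assumes "f \<in> continuous_functions" "\<And>n. g n \<in> continuous_functions"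
  shows "limitin cc_topology g f F \<longleftrightarrow> (\<forall>K. compact K \<longrightarrow> uniform_limit K g f F)"
proof
  assume lim: "limitin cc_topology g f F"
  show "\<forall>K. compact K \<longrightarrow> uniform_limit K g f F"
  proof (intro allI impI uniform_limitI)
    fix K :: "'a set" and e :: real assume K: "compact K" and e: "e > 0"
    define U where "U = {h \<in> continuous_functions. \<exists>d>0. \<forall>y\<in>K. dist (h y) (f y) \<le> e - d}"
    have "openin cc_topology U"
      unfolding openin_cc_topology
    proof (intro conjI ballI)
      show "U \<subseteq> continuous_functions" by (auto simp: U_def)
      fix h assume "h \<in> U"
      then obtain d where d: "d > 0" "\<forall>y\<in>K. dist (h y) (f y) \<le> e - d" by (auto simp: U_def)
      have "{g \<in> continuous_functions. \<forall>y\<in>K. dist (g y) (h y) < d/2} \<subseteq> U"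
      proof clarify
        fix g' assume g': "g' \<in> continuous_functions" "\<forall>y\<in>K. dist (g' y) (h y) < d/2"
        have "\<forall>y\<in>K. dist (g' y) (f y) \<le> e - d/2"
        proof
          fix y assume y: "y \<in> K"
          have "dist (g' y) (f y) \<le> dist (g' y) (h y) + dist (h y) (f y)" by (rule dist_triangle)
          then show "dist (g' y) (f y) \<le> e - d/2" using d(2) g'(2) y by fastforce
        qed
        then show "g' \<in> U" using g'(1) d(1) by (auto simp: U_def intro!: exI[of _ "d/2"])
      qed
      then show "\<exists>K e. compact K \<and> e > 0 \<and>
        {g \<in> continuous_functions. \<forall>y\<in>K. dist (g y) (h y) < e} \<subseteq> U"
        using K d(1) by (intro exI[of _ K] exI[of _ "d/2"]) auto
    qed
    moreover have "f \<in> U" using assms(1) e by (auto simp: U_def intro!: exI[of _ e])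
    ultimately have "\<forall>\<^sub>F n in F. g n \<in> U" using lim by (auto simp: limitin_def)
    then show "\<forall>\<^sub>F n in F. \<forall>y\<in>K. dist (g n y) (f y) < e"
      by eventually_elim (fastforce simp: U_def)
  qed
next
  assume lim: "\<forall>K. compact K \<longrightarrow> uniform_limit K g f F"
  show "limitin cc_topology g f F"
    unfolding limitin_def
  proof (intro conjI allI impI)
    show "f \<in> topspace cc_topology" using assms(1) by simp
    fix U assume "openin cc_topology U \<and> f \<in> U"
    then obtain K e where K: "compact K" "e > 0"
      "{g \<in> continuous_functions. \<forall>y\<in>K. dist (g y) (f y) < e} \<subseteq> U"
      unfolding openin_cc_topology by blast
    have "\<forall>\<^sub>F n in F. \<forall>y\<in>K. dist (g n y) (f y) < e"
      using lim K by (auto dest: uniform_limitD)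
    then show "\<forall>\<^sub>F n in F. g n \<in> U" by eventually_elim (use K(3) assms(2) in blast)
  qed
qed

definition const_rel :: "(('a::metric_space \<Rightarrow> real) \<times> ('a \<Rightarrow> real)) set" where
  "const_rel = {(f, g). f \<in> continuous_functions \<and> g \<in> continuous_functions \<and>
                        (\<exists>c. \<forall>y. g y = f y + c)}"

lemma equiv_const_rel:
  "equiv continuous_functions (const_rel :: (('a::metric_space \<Rightarrow> real) \<times> ('a \<Rightarrow> real)) set)"
proof (rule equivI)
  show "sym (const_rel :: (('a \<Rightarrow> real) \<times> ('a \<Rightarrow> real)) set)"
  proof (rule symI)
    fix f g :: "'a \<Rightarrow> real" assume "(f, g) \<in> const_rel"
    then obtain c where "f \<in> continuous_functions" "g \<in> continuous_functions" "\<forall>y. g y = f y + c"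
      by (auto simp: const_rel_def)
    then show "(g, f) \<in> const_rel" by (auto simp: const_rel_def intro!: exI[of _ "- c"])
  qed
  show "trans (const_rel :: (('a \<Rightarrow> real) \<times> ('a \<Rightarrow> real)) set)"
  proof (rule transI)
    fix f g h :: "'a \<Rightarrow> real" assume "(f, g) \<in> const_rel" "(g, h) \<in> const_rel"
    then obtain c d where "f \<in> continuous_functions" "h \<in> continuous_functions"
        "\<forall>y. g y = f y + c" "\<forall>y. h y = g y + d"
      by (auto simp: const_rel_def)
    then show "(f, h) \<in> const_rel" by (auto simp: const_rel_def intro!: exI[of _ "c + d"])
  qed
qed (auto simp: const_rel_def refl_on_def intro!: exI[of _ "0::real"])

definition const_class :: "('a::metric_space \<Rightarrow> real) \<Rightarrow> ('a \<Rightarrow> real) set" where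
  "const_class f = const_rel `` {f}"

definition cc_quotient_topology :: "('a::metric_space \<Rightarrow> real) set topology" where
  "cc_quotient_topology = topology (\<lambda>W. W \<subseteq> continuous_functions // const_rel \<and>
     openin cc_topology {f \<in> continuous_functions. const_class f \<in> W})"

lemma openin_cc_quotient_topology:
  "openin cc_quotient_topology W \<longleftrightarrow> W \<subseteq> continuous_functions // const_rel \<and>
     openin cc_topology {f \<in> continuous_functions. const_class f \<in> W}"
proof -
  let ?P = "\<lambda>W :: ('a \<Rightarrow> real) set set. W \<subseteq> continuous_functions // const_rel \<and>
     openin cc_topology {f \<in> continuous_functions. const_class f \<in> W}"
  have "istopology ?P"
    unfolding istopology_def
  proof (intro conjI allI impI)
    fix S T assume S: "?P S" and T: "?P T"
    show "S \<inter> T \<subseteq> continuous_functions // const_rel" using S by blast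
    have "{f \<in> continuous_functions. const_class f \<in> S \<inter> T} =
      {f \<in> continuous_functions. const_class f \<in> S} \<inter> {f \<in> continuous_functions. const_class f \<in> T}"
      by blast
    then show "openin cc_topology {f \<in> continuous_functions. const_class f \<in> S \<inter> T}"
      using S T by (simp add: openin_Int)
  next
    fix \<K> assume *: "\<forall>S\<in>\<K>. ?P S"
    show "\<Union>\<K> \<subseteq> continuous_functions // const_rel" using * by blast
    have "{f \<in> continuous_functions. const_class f \<in> \<Union>\<K>} =
      (\<Union>S\<in>\<K>. {f \<in> continuous_functions. const_class f \<in> S})" by blast
    then show "openin cc_topology {f \<in> continuous_functions. const_class f \<in> \<Union>\<K>}"
      using * by auto
  qed
  then show ?thesis by (simp add: cc_quotient_topology_def)
qed

lemma quotient_map_const_class: "quotient_map cc_topology cc_quotient_topology const_class"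
proof -
  have im: "const_class ` continuous_functions = continuous_functions // const_rel"
    by (auto simp: const_class_def quotient_def)
  have "openin cc_quotient_topology (continuous_functions // const_rel :: ('a \<Rightarrow> real) set set)"
  proof -
    have "{f \<in> continuous_functions. const_class f \<in> continuous_functions // const_rel}
        = (continuous_functions :: ('a \<Rightarrow> real) set)" using im by blast
    then show ?thesis
      using openin_topspace[of "cc_topology :: ('a \<Rightarrow> real) topology"]
      by (simp add: openin_cc_quotient_topology)
  qed
  moreover have "topspace cc_quotient_topology
      \<subseteq> (continuous_functions // const_rel :: ('a \<Rightarrow> real) set set)"
    using openin_topspace openin_cc_quotient_topology by (rule iffD1[THEN conjunct1, rotated])
  ultimately have "topspace cc_quotient_topology =
      (continuous_functions // const_rel :: ('a \<Rightarrow> real) set set)"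
    by (meson openin_subset subset_antisym)
  then show ?thesis
    by (simp add: quotient_map_def im openin_cc_quotient_topology)
qed


section \<open>The Gromov boundary\<close>

definition gromov_embedding :: "'a::metric_space \<Rightarrow> ('a \<Rightarrow> real) set" where
  "gromov_embedding x = const_class (\<lambda>y. dist x y)"

definition gromov_boundary :: "('a::metric_space \<Rightarrow> real) set set" where
  "gromov_boundary = cc_quotient_topology closure_of (range gromov_embedding) - range gromov_embedding"

definition boundary_fun :: "'a::metric_space \<Rightarrow> ('a \<Rightarrow> real) set \<Rightarrow> 'a \<Rightarrow> real" where
  "boundary_fun orig \<theta> = (THE f. f \<in> \<theta> \<and> f orig = 0)"

lemma boundary_fun_const_class:
  assumes "f \<in> continuous_functions"
  shows "boundary_fun orig (const_class f) = (\<lambda>y. f y - f orig)"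
  unfolding boundary_fun_def
proof (rule the_equality)
  have "(\<lambda>y. f y - f orig) \<in> continuous_functions"
    using assms by (auto simp: continuous_functions_def intro!: continuous_intros)
  then show "(\<lambda>y. f y - f orig) \<in> const_class f \<and> f orig - f orig = 0"
    using assms by (auto simp: const_class_def const_rel_def intro!: exI[of _ "- f orig"])
next
  fix g assume g: "g \<in> const_class f \<and> g orig = 0"
  then obtain c where c: "\<forall>y. g y = f y + c" by (auto simp: const_class_def const_rel_def)
  then have "c = - f orig" using g by (metis add.commute add_eq_0_iff)
  then show "g = (\<lambda>y. f y - f orig)" using c by auto
qed

definition gromov_converges ::
    "'a::metric_space \<Rightarrow> (nat \<Rightarrow> 'a) \<Rightarrow> ('a \<Rightarrow> real) set \<Rightarrow> bool" where
  "gromov_converges orig x \<theta> \<longleftrightarrow>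
     (\<forall>K. compact K \<longrightarrow>
        uniform_limit K (\<lambda>k y. dist (x k) y - dist (x k) orig) (boundary_fun orig \<theta>) sequentially)"


section \<open>Voronoi diagrams\<close>

text \<open>Sequences indexed by \<open>i \<ge> 1\<close> in the mathematical text are indexed by \<open>nat\<close> from \<open>0\<close> here.\<close>

definition Vor :: "(nat \<Rightarrow> 'a::metric_space) \<Rightarrow> nat \<Rightarrow> 'a set" where
  "Vor x i = {w. \<forall>j. dist w (x i) \<le> dist w (x j)}"

definition ideal_Vor ::
    "'a::metric_space \<Rightarrow> (nat \<Rightarrow> ('a \<Rightarrow> real) set \<times> real) \<Rightarrow> nat \<Rightarrow> 'a set" where
  "ideal_Vor orig p i = {x. \<forall>j. j \<noteq> i \<longrightarrow>
     boundary_fun orig (fst (p i)) x + snd (p i) \<le> boundary_fun orig (fst (p j)) x + snd (p j)}"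

definition ideal_Vor_strict ::
    "'a::metric_space \<Rightarrow> (nat \<Rightarrow> ('a \<Rightarrow> real) set \<times> real) \<Rightarrow> nat \<Rightarrow> 'a set" where
  "ideal_Vor_strict orig p i = {x. \<forall>j. j \<noteq> i \<longrightarrow>
     boundary_fun orig (fst (p i)) x + snd (p i) < boundary_fun orig (fst (p j)) x + snd (p j)}"

definition nondegenerate_ideal_Vor ::
    "'a::metric_space \<Rightarrow> (nat \<Rightarrow> ('a \<Rightarrow> real) set \<times> real) \<Rightarrow> bool" where
  "nondegenerate_ideal_Vor orig p \<longleftrightarrow>
     (\<forall>i. closure (ideal_Vor_strict orig p i) = ideal_Vor orig p i)"


section \<open>Convergence of diagrams\<close>

text \<open>The underlying set is the set of all closed sets, including the empty set:
  take \<open>K = {}\<close> in the first family.\<close>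

definition fell_topology :: "'a::topological_space set topology" where
  "fell_topology = topology_generated_by
     ({{F. closed F \<and> F \<inter> K = {}} |K. compact K} \<union>
      {{F. closed F \<and> F \<inter> G \<noteq> {}} |G. open G})"

lemma topspace_fell_topology [simp]: "topspace fell_topology = {F. closed F}"
  unfolding fell_topology_def topology_generated_by_topspace
proof
  have "{F :: 'a set. closed F \<and> F \<inter> {} = {}} \<in> {{F. closed F \<and> F \<inter> K = {}} |K. compact K}"
    using compact_empty by blast
  then show "{F :: 'a set. closed F} \<subseteq> \<Union>({{F. closed F \<and> F \<inter> K = {}} |K. compact K} \<union>
      {{F. closed F \<and> F \<inter> G \<noteq> {}} |G. open G})" by auto
qed blast

definition diagrams_converge ::
    "(nat \<Rightarrow> nat \<Rightarrow> 'a::topological_space set) \<Rightarrow> (nat \<Rightarrow> 'a set) \<Rightarrow> bool" where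
  "diagrams_converge C D \<longleftrightarrow> (\<forall>i. limitin fell_topology (\<lambda>k. C k i) (D i) sequentially)"

end

theory Submission
  imports Defs
begin

text \<open>
  Put \<open>h k i y = dist (x k i) y - dist (x k 0) orig\<close>. The subtracted constant does not depend on
  the site \<open>i\<close>, so the cells of the diagram of \<open>x k\<close> compare the functions \<open>h k i\<close>. By convergence
  to the boundary and of the proto-delays, \<open>h k i\<close> tends pointwise to
  \<open>g i = boundary_fun orig (\<theta> i) + \<delta> i\<close>, and the ideal cells compare the functions \<open>g i\<close>. Since
  all \<open>h k i\<close> are 1-Lipschitz, this pointwise convergence is strong enough for the two kinds of
  sub-basic neighbourhoods in the Fell topology.

  \<^item> \<open>F \<inter> K = {}\<close> for a compact \<open>K\<close>. A point outside the limit cell has \<open>g j < g i\<close> for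
    some \<open>j\<close>. By equicontinuity pointwise convergence turns this into \<open>h k j < h k i\<close> on a whole
    ball, for all large \<open>k\<close>, so the cells eventually avoid that ball; finitely many such balls
    cover \<open>K\<close> (lemma \<open>eventually_closer_on_ball\<close>).

  \<^item> \<open>F \<inter> G \<noteq> {}\<close> for an open \<open>G\<close>. By nondegeneracy \<open>G\<close> contains a point \<open>w\<close> of the strict cell,
    and it suffices that \<open>w\<close> eventually lies in the approximating cell. Each single competitor
    \<open>j\<close> eventually loses at \<open>w\<close>. That all of them lose simultaneously is where the ranking and
    the divergence of \<open>\<delta>\<close> enter: some site \<open>N\<close> has a delay so large that it is far behind at \<open>w\<close>, and
    the sites after \<open>N\<close> are at least as far from the origin as \<open>N\<close>, for every \<open>k\<close> (lemma
    \<open>eventually_strict_point_in_Vor\<close>).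
\<close>

text \<open>Neighbourhoods need only be tested on a subbase, because a generated open set is built by
  finite intersections and arbitrary unions, and both constructions preserve that a neighbourhood
  of \<open>l\<close> eventually contains \<open>f k\<close>.\<close>

lemma limitin_topology_generated_by:
  assumes "l \<in> \<Union>S"
    and sub: "\<And>U. U \<in> S \<Longrightarrow> l \<in> U \<Longrightarrow> \<forall>\<^sub>F k in F. f k \<in> U"
  shows "limitin (topology_generated_by S) f l F"
  unfolding limitin_def
proof (intro conjI allI impI)
  show "l \<in> topspace (topology_generated_by S)"
    using assms(1) by (simp add: topology_generated_by_topspace)
  fix U assume U: "openin (topology_generated_by S) U \<and> l \<in> U"
  then have "generate_topology_on S U"
    by (simp add: openin_topology_generated_by_iff)
  moreover have "l \<in> U" using U by simp
  ultimately show "\<forall>\<^sub>F k in F. f k \<in> U"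
  proof (induction rule: generate_topology_on.induct)
    case (Int A B)
    then show ?case by (simp add: eventually_conj)
  next
    case (UN K)
    then obtain A where "A \<in> K" "\<forall>\<^sub>F k in F. f k \<in> A" by blast
    then show ?case by (auto elim: eventually_mono)
  qed (use sub in auto)
qed

lemma limitin_fell_topologyI:
  assumes "closed D" "\<And>k. closed (C k)"
    and miss: "\<And>K. compact K \<Longrightarrow> D \<inter> K = {} \<Longrightarrow> \<forall>\<^sub>F k in F. C k \<inter> K = {}"
    and hit: "\<And>G. open G \<Longrightarrow> D \<inter> G \<noteq> {} \<Longrightarrow> \<forall>\<^sub>F k in F. C k \<inter> G \<noteq> {}"
  shows "limitin fell_topology C D F"
  unfolding fell_topology_def
proof (rule limitin_topology_generated_by)
  show "D \<in> \<Union>({{F. closed F \<and> F \<inter> K = {}} |K. compact K} \<union>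
      {{F. closed F \<and> F \<inter> G \<noteq> {}} |G. open G})"
    using assms(1) topspace_fell_topology
    unfolding fell_topology_def topology_generated_by_topspace by blast
next
  fix U assume U: "U \<in> {{F. closed F \<and> F \<inter> K = {}} |K. compact K} \<union>
      {{F. closed F \<and> F \<inter> G \<noteq> {}} |G. open G}" and "D \<in> U"
  from U show "\<forall>\<^sub>F k in F. C k \<in> U"
  proof
    assume "U \<in> {{F. closed F \<and> F \<inter> K = {}} |K. compact K}"
    with \<open>D \<in> U\<close> assms(2) show ?thesis by (auto intro: miss)
  next
    assume "U \<in> {{F. closed F \<and> F \<inter> G \<noteq> {}} |G. open G}"
    then obtain G where "open G" "U = {F. closed F \<and> F \<inter> G \<noteq> {}}" by blast
    with \<open>D \<in> U\<close> hit[of G] assms(2) show ?thesis by simp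
  qed
qed

text \<open>The origin-normalised distance to the site, plus its proto-delay; the two occurrences of the
  distance from the origin to the site cancel.\<close>

lemma renormalised_distance_tendsto:
  assumes "gromov_converges orig y \<theta>"
    and "(\<lambda>k. dist (y k) orig - c k) \<longlonglongrightarrow> \<delta>"
  shows "(\<lambda>k. dist (y k) w - c k) \<longlonglongrightarrow> boundary_fun orig \<theta> w + \<delta>"
proof -
  have "uniform_limit {w} (\<lambda>k v. dist (y k) v - dist (y k) orig) (boundary_fun orig \<theta>) sequentially"
    using assms(1) unfolding gromov_converges_def by (metis compact_sing)
  then have "(\<lambda>k. dist (y k) w - dist (y k) orig) \<longlonglongrightarrow> boundary_fun orig \<theta> w"
    by (rule tendsto_uniform_limitI) simp
  from tendsto_add[OF this assms(2)] show ?thesis by simp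
qed

lemma closed_Vor: "closed (Vor x i)"
proof -
  have "closed {w. dist w (x i) \<le> dist w (x j)}" for j
    by (intro closed_Collect_le continuous_intros)
  then show ?thesis
    unfolding Vor_def by (intro closed_Collect_all)
qed

text \<open>A point that prefers \<open>y\<close> to \<open>x\<close> in the limit, by a margin of \<open>4e\<close>, prefers it
  by a margin of \<open>2e\<close> for all large \<open>k\<close>; moving by less than \<open>e\<close> changes each of the two
  distances by less than \<open>e\<close>.\<close>

lemma eventually_closer_on_ball:
  fixes x y :: "nat \<Rightarrow> 'a::metric_space"
  assumes x: "(\<lambda>k. dist (x k) w - c k) \<longlonglongrightarrow> a"
    and y: "(\<lambda>k. dist (y k) w - c k) \<longlonglongrightarrow> b"
    and "b < a"
  shows "\<exists>e>0. \<forall>\<^sub>F k in sequentially. \<forall>v\<in>ball w e. dist v (y k) < dist v (x k)"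
proof -
  define e where "e = (a - b) / 4"
  have e: "e > 0" "a - e = b + e + 2 * e" using \<open>b < a\<close> by (auto simp: e_def field_simps)
  have "\<forall>\<^sub>F k in sequentially. a - e < dist (x k) w - c k"
    using x e(1) by (intro order_tendstoD) auto
  moreover have "\<forall>\<^sub>F k in sequentially. dist (y k) w - c k < b + e"
    using y e(1) by (intro order_tendstoD) auto
  ultimately have "\<forall>\<^sub>F k in sequentially. \<forall>v\<in>ball w e. dist v (y k) < dist v (x k)"
  proof eventually_elim
    case (elim k)
    show ?case
    proof
      fix v assume "v \<in> ball w e"
      then have "dist w v < e" by simp
      moreover have "dist v (y k) \<le> dist w v + dist (y k) w"
        by (metis dist_triangle2 dist_commute)
      moreover have "dist (x k) w \<le> dist w v + dist v (x k)"
        by (metis dist_triangle dist_commute)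
      ultimately show "dist v (y k) < dist v (x k)" using elim e(2) by linarith
    qed
  qed
  with e(1) show ?thesis by blast
qed

lemma eventually_Vor_avoids_compact:
  fixes x :: "nat \<Rightarrow> nat \<Rightarrow> 'a::metric_space"
  assumes lim: "\<And>i w. (\<lambda>k. dist (x k i) w - c k) \<longlonglongrightarrow> boundary_fun orig (\<theta> i) w + \<delta> i"
    and "compact K" and disj: "ideal_Vor orig (\<lambda>i. (\<theta> i, \<delta> i)) i \<inter> K = {}"
  shows "\<forall>\<^sub>F k in sequentially. Vor (x k) i \<inter> K = {}"
proof -
  have "\<exists>e>0. \<forall>\<^sub>F k in sequentially. Vor (x k) i \<inter> ball w e = {}" if "w \<in> K" for w
  proof -
    have "w \<notin> ideal_Vor orig (\<lambda>i. (\<theta> i, \<delta> i)) i" using disj that by blast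
    then obtain j where
      "boundary_fun orig (\<theta> j) w + \<delta> j < boundary_fun orig (\<theta> i) w + \<delta> i"
      by (auto simp: ideal_Vor_def not_le)
    from eventually_closer_on_ball[OF lim lim this] obtain e where e: "e > 0"
      "\<forall>\<^sub>F k in sequentially. \<forall>v\<in>ball w e. dist v (x k j) < dist v (x k i)" by blast
    from e(2) have "\<forall>\<^sub>F k in sequentially. Vor (x k) i \<inter> ball w e = {}"
      by eventually_elim (auto simp: Vor_def simp flip: not_less)
    with e(1) show ?thesis by blast
  qed
  then obtain r where r: "\<And>w. w \<in> K \<Longrightarrow> r w > 0"
    "\<And>w. w \<in> K \<Longrightarrow> \<forall>\<^sub>F k in sequentially. Vor (x k) i \<inter> ball w (r w) = {}" by metis
  have "K \<subseteq> (\<Union>w\<in>K. ball w (r w))" using r(1) by force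
  with \<open>compact K\<close> obtain W where W: "W \<subseteq> K" "finite W" "K \<subseteq> (\<Union>w\<in>W. ball w (r w))"
    using compactE_image[of K K "\<lambda>w. ball w (r w)"] by (metis open_ball)
  have "\<forall>\<^sub>F k in sequentially. \<forall>w\<in>W. Vor (x k) i \<inter> ball w (r w) = {}"
    using W(1,2) r(2) by (intro eventually_ball_finite) auto
  then show ?thesis by eventually_elim (use W(3) in blast)
qed

text \<open>Convergence at a single site is not uniform over the infinitely many competitors. A site \<open>N\<close>
  of large delay settles all of its successors at once: by the ranking they are at least as far
  from the origin as \<open>N\<close>, and passing from the origin to \<open>w\<close> costs at most \<open>dist w orig\<close>.\<close>

lemma eventually_strict_point_in_Vor:
  fixes x :: "nat \<Rightarrow> nat \<Rightarrow> 'a::metric_space"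
  assumes lim: "\<And>i w. (\<lambda>k. dist (x k i) w - c k) \<longlonglongrightarrow> boundary_fun orig (\<theta> i) w + \<delta> i"
    and delay: "\<And>i. (\<lambda>k. dist (x k i) orig - c k) \<longlonglongrightarrow> \<delta> i"
    and ranked: "\<And>k. mono (\<lambda>i. dist orig (x k i))"
    and infty: "filterlim \<delta> at_top sequentially"
    and w: "w \<in> ideal_Vor_strict orig (\<lambda>i. (\<theta> i, \<delta> i)) i"
  shows "\<forall>\<^sub>F k in sequentially. w \<in> Vor (x k) i"
proof -
  define g where "g j = boundary_fun orig (\<theta> j) w + \<delta> j" for j
  have "\<forall>\<^sub>F N in sequentially. g i + dist w orig < \<delta> N"
    using infty by (simp add: filterlim_at_top_dense)
  then obtain N where N: "g i + dist w orig < \<delta> N"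
    using eventually_happens'[OF sequentially_bot] by blast
  have diff: "(\<lambda>k. (dist (x k j) w - c k) - (dist (x k i) w - c k)) \<longlonglongrightarrow> g j - g i" for j
    unfolding g_def by (intro tendsto_diff lim)
  have near: "\<forall>\<^sub>F k in sequentially. \<forall>j\<in>{..<N}. dist w (x k i) \<le> dist w (x k j)"
  proof (intro eventually_ball_finite ballI)
    fix j
    show "\<forall>\<^sub>F k in sequentially. dist w (x k i) \<le> dist w (x k j)"
    proof (cases "j = i")
      case False
      then have "g j - g i > 0" using w by (auto simp: ideal_Vor_strict_def g_def)
      from order_tendstoD(1)[OF diff this] show ?thesis
        by eventually_elim (simp add: dist_commute)
    qed simp
  qed simp
  have "(\<lambda>k. (dist (x k N) orig - c k) - (dist (x k i) w - c k)) \<longlonglongrightarrow> \<delta> N - g i"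
    unfolding g_def by (intro tendsto_diff lim delay)
  moreover have "dist w orig < \<delta> N - g i" using N by simp
  ultimately have "\<forall>\<^sub>F k in sequentially.
      dist w orig < (dist (x k N) orig - c k) - (dist (x k i) w - c k)"
    by (rule order_tendstoD)
  with near show ?thesis
  proof eventually_elim
    case (elim k)
    have "dist w (x k i) \<le> dist w (x k j)" for j
    proof (cases "j < N")
      case False
      then have "dist orig (x k N) \<le> dist orig (x k j)" using monoD[OF ranked, of N j k] by simp
      also have "\<dots> \<le> dist w orig + dist w (x k j)" by (metis dist_triangle3)
      finally show ?thesis using elim(2) by (simp add: dist_commute)
    qed (use elim(1) in simp)
    then show ?case by (simp add: Vor_def)
  qed
qed

theorem theorem2p3:
  fixes orig :: "'a::metric_space"
    and x :: "nat \<Rightarrow> nat \<Rightarrow> 'a"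
    and \<theta> :: "nat \<Rightarrow> ('a \<Rightarrow> real) set"
    and \<delta> :: "nat \<Rightarrow> real"
  assumes locally_compact: "locally compact (UNIV :: 'a set)"
    and boundedly_compact: "\<And>S :: 'a set. bounded S \<Longrightarrow> closed S \<Longrightarrow> compact S"
    and distinct_points: "\<And>k. inj (x k)"
    and ranked: "\<And>k. mono (\<lambda>i. dist orig (x k i))"
    and to_infinity: "\<And>k. filterlim (\<lambda>i. dist orig (x k i)) at_top sequentially"
    and boundary_points: "\<And>i. \<theta> i \<in> gromov_boundary"
    and convergence_to_boundary: "\<And>i. gromov_converges orig (\<lambda>k. x k i) (\<theta> i)"
    and proto_delays: "\<And>i. (\<lambda>k. dist (x k i) orig - dist (x k 0) orig) \<longlonglongrightarrow> \<delta> i"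
    and delays_to_infinity: "filterlim \<delta> at_top sequentially"
    and nondegenerate: "nondegenerate_ideal_Vor orig (\<lambda>i. (\<theta> i, \<delta> i))"
  shows "diagrams_converge (\<lambda>k. Vor (x k)) (ideal_Vor orig (\<lambda>i. (\<theta> i, \<delta> i)))"
  unfolding diagrams_converge_def
proof
  fix i
  let ?p = "\<lambda>i. (\<theta> i, \<delta> i)"
  have lim: "(\<lambda>k. dist (x k j) w - dist (x k 0) orig) \<longlonglongrightarrow> boundary_fun orig (\<theta> j) w + \<delta> j" for j w
    using convergence_to_boundary proto_delays by (rule renormalised_distance_tendsto)
  have closure: "closure (ideal_Vor_strict orig ?p i) = ideal_Vor orig ?p i"
    using nondegenerate by (simp add: nondegenerate_ideal_Vor_def)
  show "limitin fell_topology (\<lambda>k. Vor (x k) i) (ideal_Vor orig ?p i) sequentially"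
  proof (rule limitin_fell_topologyI)
    show "closed (ideal_Vor orig ?p i)" using closed_closure closure by metis
    show "closed (Vor (x k) i)" for k by (rule closed_Vor)
    show "\<forall>\<^sub>F k in sequentially. Vor (x k) i \<inter> K = {}"
      if "compact K" "ideal_Vor orig ?p i \<inter> K = {}" for K
      using lim that by (rule eventually_Vor_avoids_compact)
    show "\<forall>\<^sub>F k in sequentially. Vor (x k) i \<inter> G \<noteq> {}"
      if G: "open G" "ideal_Vor orig ?p i \<inter> G \<noteq> {}" for G
    proof -
      have "ideal_Vor_strict orig ?p i \<inter> G \<noteq> {}"
        using G closure open_Int_closure_eq_empty[of G "ideal_Vor_strict orig ?p i"] by blast
      then obtain w where w: "w \<in> ideal_Vor_strict orig ?p i" "w \<in> G" by blast
      have "\<forall>\<^sub>F k in sequentially. w \<in> Vor (x k) i"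
        using lim proto_delays ranked delays_to_infinity w(1)
        by (rule eventually_strict_point_in_Vor)
      then show ?thesis by eventually_elim (use w(2) in blast)
    qed
  qed
qed

end
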